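(* Let $n$ be a positive even integer, $t=n/2$, let $W_1,\ldots,W_{3^t+1}$ be $t$-dimensional subspaces of $\mathbb{F}_3^n$ with pairwise intersection $\{\mathbf{0}\}$, let $1\le s\le \frac{3^t+1}{2}$, let $i_1,\ldots,i_{2s}$ be distinct elements of $\{1,\ldots,3^t+1\}$, and let $f=\sum_{k=1}^{s} f_{i_k i_{s+k}}:\mathbb{F}_3^n\to\mathbb{F}_3$ (with $f_{ij}$ as defined in the context). Then $\mathscr{C}_f$ is a $[3^n-1,n+1]$ linear code over $\mathbb{F}_3$ whose weight distribution is as follows (weight: multiplicity, i.e. number of codewords with that weight): \begin{itemize} \item weight $0$: multiplicity $1$; \item weight $2s(3^t-1)$: multiplicity $2$; \item weight $3^n-3^{n-1}$: multiplicity $3^n-1$; \item weight $3^n-3^{n-1}-2s$: multiplicity $4s(3^t-1)$; \item weight $3^n-3^{n-1}+3^t-2s$: multiplicity $2(3^t+1-2s)(3^t-1)$. \end{itemize}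
   Context: For $i\neq j$ in $\{1,\ldots,3^t+1\}$, $f_{ij}:\mathbb{F}_3^n\to\mathbb{F}_3=\{0,1,2\}$ is defined by $f_{ij}(\mathbf{x})=1$ if $\mathbf{x}\in W_i\setminus\{\mathbf{0}\}$, $f_{ij}(\mathbf{x})=2$ if $\mathbf{x}\in W_j\setminus\{\mathbf{0}\}$, and $f_{ij}(\mathbf{x})=0$ otherwise. For a function $f:\mathbb{F}_3^n\to\mathbb{F}_3$, $$\mathscr{C}_f=\{(\alpha f(\mathbf{x})+\mathbf{w}\cdot\mathbf{x})_{\mathbf{x}\in\mathbb{F}_3^n\setminus\{\mathbf{0}\}} \mid \alpha\in\mathbb{F}_3,\ \mathbf{w}\in\mathbb{F}_3^n\},$$ where $\cdot$ is the standard inner product; coordinates are indexed by the nonzero vectors of $\mathbb{F}_3^n$. An $[N,k]$ linear code over $\mathbb{F}_3$ is a $k$-dimensional subspace of $\mathbb{F}_3^N$. The weight of a codeword is its Hamming weight (number of nonzero coordinates).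
   Formalization: The multiplicities of the last two weights are interchanged: weight 3^n-3^{n-1}-2s has multiplicity 2(3^t+1-2s)(3^t-1) and weight 3^n-3^{n-1}+3^t-2s has 4s(3^t-1); the table as printed fails e.g. for n=2, s=2. Multiplicities of coinciding weights are added. *)

theory Defs
  imports "HOL-Analysis.Analysis"
begin

typedef (overloaded) ('a :: zero_neq_one) nonzero = "{x :: 'a. x \<noteq> 0}"
  morphisms nonzero_val Abs_nonzero
  by (rule exI[of _ 1]) simp

instance nonzero :: ("{finite, zero_neq_one}") finite
proof
  have "inj (nonzero_val :: 'a nonzero \<Rightarrow> 'a)"
    by (rule injI) (simp add: nonzero_val_inject)
  then show "finite (UNIV :: 'a nonzero set)"
    by (meson finite_imageD finite_subset subset_UNIV finite)
qed

text \<open>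
  Over a field with three elements the values below are the field elements 1, 2 (= -1) and 0.
\<close>

definition f_pair :: "(nat \<Rightarrow> ('k :: field ^ 'n) set) \<Rightarrow> nat \<Rightarrow> nat \<Rightarrow> 'k ^ 'n \<Rightarrow> 'k" where
  "f_pair W i j x =
     (if x \<in> W i - {0} then 1 else if x \<in> W j - {0} then 2 else 0)"

text \<open>
  The coordinates of a codeword are indexed by the type of nonzero vectors, so that the ambient
  space is a vector space in the sense of the library, of dimension one less than the number of
  vectors.
\<close>

definition code_of :: "('k :: {field, finite} ^ 'n \<Rightarrow> 'k) \<Rightarrow> ('k ^ ('k ^ 'n) nonzero) set" where
  "code_of f =
     {\<chi> x. \<alpha> * f (nonzero_val x) + scalar_product w (nonzero_val x) | \<alpha> w. True}"

definition linear_code :: "nat \<Rightarrow> nat \<Rightarrow> ('k :: field ^ 'i) set \<Rightarrow> bool" where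
  "linear_code N k C \<longleftrightarrow> CARD('i) = N \<and> vec.subspace C \<and> vec.dim C = k"

definition hamming_weight :: "'k :: zero ^ 'i \<Rightarrow> nat" where
  "hamming_weight c = card {i. c $ i \<noteq> 0}"

text \<open>
  A weight distribution is given by a list of pairs (weight, multiplicity); a weight that is not
  listed does not occur. For special parameters two listed weights may coincide (for
  s = 3^(t-1), the weights 2s(3^t-1) and 3^n-3^(n-1)-2s), and then their multiplicities add up.

  The source of the theorem interchanges the multiplicities of the two weights
  3^n-3^(n-1)-2s and 3^n-3^(n-1)+3^t-2s; as printed there, its table is false unless
  4s = 3^t+1 (for n = 2, s = 2 there is no word of weight 2, but 16 words of weight 5). The theorem is
  stated with the corrected table. Indeed, the hyperplane orthogonal to a nonzero w contains
  exactly one of the W_j. For a word with both coefficients nonzero, the weight is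
  3^n-3^(n-1)+3^t-2s if this W_j is one of the 2s subspaces occurring in f, which accounts for
  2 * 2s(3^t-1) words, and 3^n-3^(n-1)-2s otherwise.
\<close>

definition has_weight_distribution :: "('k :: zero ^ 'i) set \<Rightarrow> (nat \<times> nat) list \<Rightarrow> bool" where
  "has_weight_distribution C table \<longleftrightarrow>
     finite C \<and>
     (\<forall>v. card {c \<in> C. hamming_weight c = v} = (\<Sum>(u, m) \<leftarrow> table. if u = v then m else 0))"

end

theory Submission
  imports Defs
begin

text \<open>
  By counting, the subspaces \<open>W j\<close> cover the whole space, so they form a spread, and f is constant
  on every \<open>W j - {0}\<close>, with a nonzero value for exactly 2s indices j. Hence the weight of the
  word with coefficients a and w splits into a sum over j. If w does not vanish identically on
  \<open>W j\<close>, it takes every value equally often there; comparing with the size of the hyperplane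
  orthogonal to w shows that a nonzero w vanishes on exactly one \<open>W j\<close>. The weight therefore
  only depends on whether a = 0, whether w = 0, and whether f is nonzero on this \<open>W j\<close>.
  Since all nonzero coefficient pairs have positive weight, the encoding is injective, and this
  gives the dimension as well.
\<close>

section \<open>Bilinearity and nondegeneracy of the scalar product\<close>

lemma scalar_product_add_right:
  "scalar_product w (x + y) = scalar_product w x + scalar_product w y"
  by (simp add: scalar_product_def distrib_left sum.distrib)

lemma scalar_product_add_left:
  "scalar_product (v + w) x = scalar_product v x + scalar_product w x"
  by (simp add: scalar_product_def distrib_right sum.distrib)

lemma scalar_product_scale_right:
  fixes w x :: "'k :: comm_semiring_1 ^ 'n"
  shows "scalar_product w (c *s x) = c * scalar_product w x"
  by (simp add: scalar_product_def sum_distrib_left ac_simps)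

lemma scalar_product_scale_left:
  "scalar_product (c *s w) x = c * scalar_product w x"
  by (simp add: scalar_product_def sum_distrib_left ac_simps)

lemma scalar_product_commute:
  fixes w x :: "'k :: comm_semiring_1 ^ 'n"
  shows "scalar_product w x = scalar_product x w"
  by (simp add: scalar_product_def mult.commute)

lemma scalar_product_zero [simp]:
  "scalar_product w 0 = 0" "scalar_product 0 w = 0"
  by (simp_all add: scalar_product_def)

lemma scalar_product_axis:
  "scalar_product w (axis j 1) = w $ j"
  by (simp add: scalar_product_def axis_def if_distrib cong: if_cong)

text \<open>A unit vector at a nonzero coordinate of \<open>w\<close> is a witness.\<close>

lemma ex_scalar_product_nonzero:
  assumes "w \<noteq> 0"
  shows "\<exists>x. scalar_product w x \<noteq> 0"
  using assms by (metis scalar_product_axis vec_eq_iff zero_index)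

section \<open>Cardinalities of subspaces, level sets and annihilators over a finite field\<close>

lemma card_field_gt_1: "CARD('k :: {field, finite}) > 1"
proof -
  have "card {0 :: 'k, 1} \<le> CARD('k)"
    by (rule card_mono) auto
  then show ?thesis by simp
qed

text \<open>Induction on the basis: an element of the larger span is \<open>k *s b + x\<close> for
  exactly one \<open>k\<close> and one \<open>x\<close> in the smaller span, since two different
  values of \<open>k\<close> would put \<open>b\<close> into that span. Each new basis vector thus
  multiplies the size by the size of the field.\<close>

lemma card_vec_span:
  fixes B :: "('k :: {field, finite} ^ 'n) set"
  assumes "vec.independent B"
  shows "card (vec.span B) = CARD('k) ^ card B"
proof -
  have "finite B" by simp
  then show ?thesis using assms
  proof (induction B rule: finite_induct)
    case empty
    then show ?case by simp
  next
    case (insert b B)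
    then have b: "b \<notin> vec.span B" and B: "vec.independent B"
      by (auto simp: vec.independent_insert)
    let ?g = "\<lambda>(k :: 'k, x). k *s b + x"
    have "vec.span (insert b B) = ?g ` (UNIV \<times> vec.span B)"
    proof (intro set_eqI iffI)
      fix x assume "x \<in> vec.span (insert b B)"
      then obtain k where "x - k *s b \<in> vec.span B"
        by (auto simp: vec.span_breakdown_eq)
      then show "x \<in> ?g ` (UNIV \<times> vec.span B)"
        by (intro image_eqI[of _ _ "(k, x - k *s b)"]) auto
    next
      fix x assume "x \<in> ?g ` (UNIV \<times> vec.span B)"
      then obtain k y where "x = k *s b + y" "y \<in> vec.span B" by auto
      then have "x - k *s b \<in> vec.span B" by simp
      then show "x \<in> vec.span (insert b B)"
        unfolding vec.span_breakdown_eq by blast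
    qed
    moreover have "inj_on ?g (UNIV \<times> vec.span B)"
    proof (rule inj_onI, clarsimp)
      fix k l :: 'k and x y
      assume xy: "x \<in> vec.span B" "y \<in> vec.span B" and eq: "k *s b + x = l *s b + y"
      have "(k - l) *s b = y - x"
        using eq by (simp add: algebra_simps)
      then have *: "(k - l) *s b \<in> vec.span B"
        using xy by (simp add: vec.span_diff)
      have "k = l"
      proof (rule ccontr)
        assume "k \<noteq> l"
        then have "inverse (k - l) *s ((k - l) *s b) = b"
          unfolding vec.scale_scale by simp
        then have "b \<in> vec.span B"
          using vec.span_scale[OF *, of "inverse (k - l)"] by (simp only:)
        with b show False ..
      qed
      with eq show "k = l \<and> x = y" by simp
    qed
    ultimately show ?case
      using insert.IH[OF B] insert.hyps by (simp add: card_image card_cartesian_product)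
  qed
qed

lemma card_vec_subspace:
  fixes V :: "('k :: {field, finite} ^ 'n) set"
  assumes "vec.subspace V"
  shows "card V = CARD('k) ^ vec.dim V"
proof -
  obtain B where B: "B \<subseteq> V" "vec.independent B" "V \<subseteq> vec.span B" "card B = vec.dim V"
    using vec.basis_exists[of V] .
  then have "vec.span B = V"
    using vec.span_minimal[OF B(1) assms] by blast
  then show ?thesis
    using card_vec_span[OF B(2)] B(4) by simp
qed

text \<open>Translations by multiples of \<open>y\<close> carry the level sets of
  \<open>scalar_product w\<close> on \<open>V\<close> bijectively onto each other, and these level
  sets, one for each field element, partition \<open>V\<close>.\<close>

lemma card_level_set:
  fixes V :: "('k :: {field, finite} ^ 'n) set"
  assumes V: "vec.subspace V" and y: "y \<in> V" "scalar_product w y \<noteq> 0"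
  shows "CARD('k) * card {x \<in> V. scalar_product w x = a} = card V"
proof -
  define L where "L b = {x \<in> V. scalar_product w x = b}" for b
  have eq: "card (L b) = card (L a)" for b
  proof -
    \<comment> \<open>The multiple of \<open>y\<close> on which \<open>w\<close> takes the value
      \<open>a - b\<close>, the shift that leads from level \<open>b\<close> to level
      \<open>a\<close>.\<close>
    define z where "z = ((a - b) / scalar_product w y) *s y"
    have z: "z \<in> V" "scalar_product w z = a - b"
      using y V by (auto simp: z_def vec.subspace_scale scalar_product_scale_right)
    have neg: "- z \<in> V" "scalar_product w (- z) = b - a"
      using z V scalar_product_scale_right[of w "- 1" z] by (auto simp: vec.subspace_neg)
    have "bij_betw (\<lambda>x. x + z) (L b) (L a)"
      using z neg V
      by (intro bij_betw_byWitness[where f' = "\<lambda>x. x + (- z)"])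
         (auto simp: L_def vec.subspace_add scalar_product_add_right simp del: add_uminus_conv_diff)
    then show ?thesis by (rule bij_betw_same_card)
  qed
  have "V = (\<Union>b. L b)" by (auto simp: L_def)
  then have "card V = card (\<Union>b. L b)" by simp
  also have "\<dots> = (\<Sum>b\<in>UNIV. card (L b))"
    by (rule card_UN_disjoint) (auto simp: L_def)
  also have "\<dots> = (\<Sum>b\<in>(UNIV :: 'k set). card (L a))"
    by (rule sum.cong[OF refl eq])
  finally show ?thesis by (simp add: L_def)
qed

lemma card_annihilator:
  fixes V :: "('k :: {field, finite} ^ 'n) set"
  assumes V: "vec.subspace V"
  shows "card {w. \<forall>x\<in>V. scalar_product w x = 0} * card V = CARD('k ^ 'n)"
proof -
  \<comment> \<open>S counts the orthogonal pairs in two ways; this avoids a rank-nullity argument.\<close>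
  define A where "A = {w. \<forall>x\<in>V. scalar_product w x = 0}"
  define S where "S = (\<Sum>w\<in>UNIV. card {x \<in> V. scalar_product w x = 0})"
  let ?q = "CARD('k)" and ?N = "CARD('k ^ 'n)"
  have V0: "0 \<in> V" using V by (rule vec.subspace_0)
  \<comment> \<open>First count, by \<open>w\<close>. The factor \<open>?q\<close> avoids division:
    a \<open>w\<close> outside \<open>A\<close> vanishes on exactly one \<open>?q\<close>-th of
    \<open>V\<close>.\<close>
  have "?q * S = (\<Sum>w\<in>UNIV. ?q * card {x \<in> V. scalar_product w x = 0})"
    by (simp add: S_def sum_distrib_left)
  also have "\<dots> = (\<Sum>w\<in>UNIV. if w \<in> A then ?q * card V else card V)"
  proof (rule sum.cong)
    fix w
    show "?q * card {x \<in> V. scalar_product w x = 0} = (if w \<in> A then ?q * card V else card V)"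
    proof (cases "w \<in> A")
      case True
      then have "{x \<in> V. scalar_product w x = 0} = V" by (auto simp: A_def)
      then show ?thesis using True by simp
    next
      case False
      then show ?thesis using card_level_set[OF V] by (auto simp: A_def)
    qed
  qed simp
  also have "\<dots> = card A * (?q * card V) + card (- A) * card V"
    by (simp add: sum.If_cases)
  also have "card (- A) = ?N - card A"
    by (simp add: Compl_eq_Diff_UNIV card_Diff_subset del: CARD_vec)
  finally have "?q * S = card A * (?q * card V) + (?N - card A) * card V" .
  moreover have "card A \<le> ?N" by (rule card_mono) auto
  ultimately have 1: "int (?q * S) = int (card A) * ?q * card V + (int ?N - card A) * card V"
    by (simp del: CARD_vec)
  have "S = (\<Sum>w\<in>UNIV. \<Sum>x\<in>V. if scalar_product w x = 0 then 1 else 0)"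
    by (simp add: S_def sum.If_cases Int_def)
  also have "\<dots> = (\<Sum>x\<in>V. \<Sum>w\<in>UNIV. if scalar_product w x = 0 then 1 else 0)"
    by (rule sum.swap)
  also have "\<dots> = (\<Sum>x\<in>V. card {w \<in> UNIV. scalar_product x w = 0})"
    by (simp add: sum.If_cases Int_def scalar_product_commute)
  finally have "?q * S = (\<Sum>x\<in>V. ?q * card {w \<in> UNIV. scalar_product x w = 0})"
    by (simp add: sum_distrib_left)
  \<comment> \<open>Second count, by \<open>x\<close>: a nonzero \<open>x\<close> is orthogonal to
    one \<open>?q\<close>-th of the whole space, again by \<open>card_level_set\<close>, now with
    \<open>x\<close> as the functional.\<close>
  also have "\<dots> = (\<Sum>x\<in>V. if x \<in> {0} then ?q * ?N else ?N)"
  proof (rule sum.cong)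
    fix x assume "x \<in> V"
    show "?q * card {w \<in> UNIV. scalar_product x w = 0} = (if x \<in> {0} then ?q * ?N else ?N)"
    proof (cases "x = 0")
      case False
      then obtain y where "scalar_product x y \<noteq> 0" using ex_scalar_product_nonzero by blast
      then show ?thesis
        using False card_level_set[of UNIV y x 0] by simp
    qed simp
  qed simp
  also have "\<dots> = ?q * ?N + (card V - 1) * ?N"
    using V0 by (subst sum.If_cases) (auto simp: card_Diff_singleton Diff_eq[symmetric])
  finally have S: "?q * S = ?q * ?N + (card V - 1) * ?N" .
  have 2: "int (?q * S) = int ?q * ?N + (int (card V) - 1) * ?N"
  proof -
    have "card V \<ge> 1" using V0 by (metis One_nat_def Suc_leI card_gt_0_iff empty_iff finite)
    then show ?thesis
      unfolding S of_nat_add of_nat_mult by (simp only: of_nat_diff of_nat_1)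
  qed
  \<comment> \<open>Both evaluations of \<open>?q * S\<close> contain the term
    \<open>?N * card V\<close>. Once it cancels, the positive factor \<open>?q - 1\<close> is common
    to both sides.\<close>
  have "(int ?q - 1) * (int (card A) * card V) = (int ?q - 1) * ?N"
    using trans[OF 1[symmetric] 2] by algebra
  then have "int (card A) * card V = ?N"
    unfolding mult_cancel_left using card_field_gt_1[where 'k = 'k] by linarith
  then show ?thesis by (simp only: A_def of_nat_mult[symmetric] of_nat_eq_iff)
qed

section \<open>Spreads of half-dimensional subspaces\<close>

locale spread =
  fixes W :: "'j \<Rightarrow> ('k :: {field, finite} ^ 'n) set" and J :: "'j set" and t q :: nat
  assumes q: "q = CARD('k)" and dim: "CARD('n) = 2 * t" and t: "t > 0"
    and J: "finite J" "card J = q ^ t + 1"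
    and subspace: "j \<in> J \<Longrightarrow> vec.subspace (W j)"
    and dim_W: "j \<in> J \<Longrightarrow> vec.dim (W j) = t"
    and inter: "j \<in> J \<Longrightarrow> l \<in> J \<Longrightarrow> j \<noteq> l \<Longrightarrow> W j \<inter> W l = {0}"
begin

text \<open>The size of a hyperplane of \<open>W j\<close>. Writing all counts as polynomials in
  \<open>q\<close> and \<open>Q\<close> keeps the exponent \<open>t - 1\<close> out of the
  arithmetic.\<close>

definition Q :: nat where "Q = q ^ (t - 1)"

lemma q_gt_1: "q > 1"
  unfolding q by (rule card_field_gt_1)

lemma Q_pos: "Q > 0"
  using q_gt_1 by (simp add: Q_def)

lemma power_t: "q ^ t = q * Q"
  using t by (simp add: Q_def power_eq_if)

lemma card_space: "CARD('k ^ 'n) = (q * Q) * (q * Q)"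
  by (simp add: dim mult_2 power_add power_t flip: q)

lemma card_W: "j \<in> J \<Longrightarrow> card (W j) = q * Q"
  by (simp add: card_vec_subspace subspace dim_W power_t flip: q)

lemma zero_in_W: "j \<in> J \<Longrightarrow> 0 \<in> W j"
  by (simp add: subspace vec.subspace_0)

lemma disjoint_W: "j \<in> J \<Longrightarrow> l \<in> J \<Longrightarrow> j \<noteq> l \<Longrightarrow> (W j - {0}) \<inter> (W l - {0}) = {}"
  using inter by blast

text \<open>The sets \<open>W j - {0}\<close> are disjoint, and together they have (q^t + 1)(q^t -
  1) = q^(2t) - 1 elements, as many as there are nonzero vectors.\<close>

lemma cover: "(\<Union>j\<in>J. W j - {0}) = UNIV - {0}"
proof (rule card_subset_eq)
  have "card (\<Union>j\<in>J. W j - {0}) = (\<Sum>j\<in>J. card (W j - {0}))"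
    using J disjoint_W by (intro card_UN_disjoint) auto
  also have "\<dots> = (\<Sum>j\<in>J. q * Q - 1)"
    by (intro sum.cong) (auto simp: card_Diff_singleton zero_in_W card_W)
  also have "\<dots> = (q * Q + 1) * (q * Q - 1)"
    by (simp add: J power_t)
  also have "\<dots> = (q * Q) * (q * Q) - 1"
    by (simp add: algebra_simps)
  also have "\<dots> = card (UNIV - {0 :: 'k ^ 'n})"
    by (simp add: card_Diff_singleton card_space del: CARD_vec)
  finally show "card (\<Union>j\<in>J. W j - {0}) = card (UNIV - {0 :: 'k ^ 'n})" .
qed auto

lemma card_nonzero_eq_sum:
  "card {x. x \<noteq> 0 \<and> P x} = (\<Sum>j\<in>J. card {x \<in> W j. x \<noteq> 0 \<and> P x})"
proof -
  have "{x. x \<noteq> 0 \<and> P x} = (\<Union>j\<in>J. {x \<in> W j. x \<noteq> 0 \<and> P x})"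
    using cover by blast
  also have "card \<dots> = (\<Sum>j\<in>J. card {x \<in> W j. x \<noteq> 0 \<and> P x})"
    using J disjoint_W by (intro card_UN_disjoint) auto
  finally show ?thesis .
qed

section \<open>Annihilators of the spread elements and their effect on weights\<close>

definition orth :: "'j \<Rightarrow> ('k ^ 'n) set" where
  "orth j = {w. \<forall>x\<in>W j. scalar_product w x = 0}"

lemma zero_in_orth: "0 \<in> orth j"
  by (simp add: orth_def)

lemma card_shifted_zeros:
  assumes "j \<in> J" "w \<notin> orth j"
  shows "card {x \<in> W j. scalar_product w x = a} = Q"
  using card_level_set[OF subspace[OF assms(1)], of _ w a] assms q_gt_1
  by (auto simp: orth_def card_W simp flip: q)

text \<open>If \<open>w\<close> annihilates \<open>W j\<close>, the expression is constantly
  \<open>a\<close> there. Otherwise it vanishes at \<open>Q\<close> vectors, and 0 is one of these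
  only if \<open>a = 0\<close>, so excluding 0 costs one more vector when \<open>a\<close> is
  nonzero. The form "generic value plus correction for \<open>orth j\<close>" is made for summation
  over \<open>j\<close>; the correction can be negative, hence the integers.\<close>

lemma local_weight:
  assumes j: "j \<in> J"
  shows "int (card {x \<in> W j. x \<noteq> 0 \<and> a + scalar_product w x \<noteq> 0}) =
    (int q * Q - Q) - (if a \<noteq> 0 then 1 else 0) +
    (if w \<in> orth j then (if a \<noteq> 0 then int Q else int Q - int q * Q) else 0)"
proof (cases "w \<in> orth j")
  case True
  then have eq: "{x \<in> W j. x \<noteq> 0 \<and> a + scalar_product w x \<noteq> 0} =
      (if a = 0 then {} else W j - {0})"
    by (auto simp: orth_def)
  have "q * Q > 0" using q_gt_1 Q_pos by simp
  then have "int (card (W j - {0})) = int q * Q - 1"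
    using j by (simp add: card_Diff_singleton zero_in_W card_W Suc_leI)
  then show ?thesis
    unfolding eq using True by simp
next
  case False
  let ?Z = "{x \<in> W j. scalar_product w x = - a}"
  have eq: "{x \<in> W j. x \<noteq> 0 \<and> a + scalar_product w x \<noteq> 0} = W j - ({0} \<union> ?Z)"
    by (auto simp: eq_neg_iff_add_eq_0 add.commute)
  have "card ({0} \<union> ?Z) = Q + (if a \<noteq> 0 then 1 else 0)"
    using card_shifted_zeros[OF j False, of "- a"] zero_in_W[OF j]
    by (auto simp: card_insert_if)
  moreover have "card (W j - ({0} \<union> ?Z)) = card (W j) - card ({0} \<union> ?Z)"
    using zero_in_W[OF j] by (intro card_Diff_subset) auto
  moreover have "card ({0} \<union> ?Z) \<le> card (W j)"
    using zero_in_W[OF j] by (intro card_mono) auto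
  ultimately show ?thesis
    unfolding eq using False by (simp add: card_W[OF j])
qed

text \<open>Let m be the number of \<open>j\<close> with \<open>w\<close> in \<open>orth j\<close>.
  The complement of the hyperplane of \<open>w\<close> has qQ(qQ - Q) elements, whereas the local
  counts add up to (qQ + 1 - m)(qQ - Q). Hence m = 1.\<close>

lemma ex1_orth:
  assumes "w \<noteq> 0"
  shows "\<exists>!j. j \<in> J \<and> w \<in> orth j"
proof -
  let ?S = "{j \<in> J. w \<in> orth j}"
  obtain y where y: "scalar_product w y \<noteq> 0"
    using ex_scalar_product_nonzero[OF assms] by blast
  have "q * card {x \<in> UNIV. scalar_product w x = 0} = CARD('k ^ 'n)"
    unfolding q using y by (intro card_level_set[of _ y]) auto
  then have Z: "card {x. scalar_product w x = 0} = q * Q * Q"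
    using q_gt_1 by (simp add: card_space del: CARD_vec)
  \<comment> \<open>The summand 0 is kept so that the set matches \<open>local_weight\<close> with
    \<open>a = 0\<close>.\<close>
  have "{x. x \<noteq> 0 \<and> 0 + scalar_product w x \<noteq> 0} = UNIV - {x. scalar_product w x = 0}"
    by auto
  then have "card {x. x \<noteq> 0 \<and> 0 + scalar_product w x \<noteq> 0} + q * Q * Q = q * Q * (q * Q)"
    using Z card_Diff_subset[of "{x. scalar_product w x = 0}" UNIV]
      card_mono[of UNIV "{x. scalar_product w x = 0}"]
    by (simp add: card_space del: CARD_vec)
  then have "int q * Q * (q * Q) - q * Q * Q =
      int (card {x. x \<noteq> 0 \<and> 0 + scalar_product w x \<noteq> 0})"
    unfolding of_nat_mult[symmetric] by linarith
  also have "\<dots> = (\<Sum>j\<in>J. (int q * Q - Q) + (if w \<in> orth j then int Q - int q * Q else 0))"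
    unfolding card_nonzero_eq_sum of_nat_sum by (rule sum.cong) (simp_all only: local_weight simp_thms if_False diff_zero if_cancel)
  also have "\<dots> = (int q * Q + 1) * (int q * Q - Q) + card ?S * (int Q - int q * Q)"
    by (simp add: sum.distrib J power_t sum.If_cases Int_def)
  finally have "(int q * Q - Q) * (int (card ?S) - 1) = 0"
    by (simp add: algebra_simps)
  moreover have "int q * Q - Q \<noteq> 0"
    using q_gt_1 Q_pos by (simp flip: of_nat_mult)
  ultimately have "card ?S = 1" unfolding mult_eq_0_iff by linarith
  then obtain l where "?S = {l}" by (auto simp: card_1_singleton_iff)
  then have "j \<in> J \<and> w \<in> orth j \<longleftrightarrow> j = l" for j
    by (simp add: set_eq_iff)
  then show ?thesis by simp
qed

text \<open>In the sum of the local weights every \<open>j\<close> in \<open>I\<close> costs one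
  vector. By \<open>ex1_orth\<close> the correction for \<open>orth\<close> occurs at a single
  index, and its value depends only on whether that index lies in \<open>I\<close>.\<close>

lemma weight_sum:
  assumes w: "w \<noteq> 0" and g: "\<And>j x. j \<in> J \<Longrightarrow> x \<in> W j \<Longrightarrow> x \<noteq> 0 \<Longrightarrow> g x = c j"
    and I: "I = {j \<in> J. c j \<noteq> 0}"
  shows "int (card {x. x \<noteq> 0 \<and> g x + scalar_product w x \<noteq> 0}) =
    (int q * Q + 1) * (int q * Q - Q) - card I +
    (if \<exists>j\<in>I. w \<in> orth j then int Q else int Q - int q * Q)"
proof -
  obtain l where l: "l \<in> J" "w \<in> orth l" "\<And>j. j \<in> J \<Longrightarrow> w \<in> orth j \<longleftrightarrow> j = l"
    using ex1_orth[OF w] by blast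
  have *: "card {x \<in> W j. x \<noteq> 0 \<and> g x + scalar_product w x \<noteq> 0} =
      card {x \<in> W j. x \<noteq> 0 \<and> c j + scalar_product w x \<noteq> 0}" if "j \<in> J" for j
    using g[OF that] by (intro arg_cong[where f = card]) auto
  have "int (card {x. x \<noteq> 0 \<and> g x + scalar_product w x \<noteq> 0}) =
      (\<Sum>j\<in>J. ((int q * Q - Q) - (if c j \<noteq> 0 then 1 else 0)) +
        (if j = l then (if c j \<noteq> 0 then int Q else int Q - int q * Q) else 0))"
    unfolding card_nonzero_eq_sum of_nat_sum
    by (rule sum.cong) (simp_all add: * local_weight l(3))
  also have "\<dots> = (int q * Q + 1) * (int q * Q - Q) - card I +
      (if c l \<noteq> 0 then int Q else int Q - int q * Q)"
    unfolding sum.distrib sum_subtractf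
    using J l(1) by (simp add: I power_t sum.If_cases Int_def) (simp add: algebra_simps)
  also have "c l \<noteq> 0 \<longleftrightarrow> (\<exists>j\<in>I. w \<in> orth j)"
    using l I by auto
  finally show ?thesis .
qed

lemma card_orth:
  assumes "j \<in> J"
  shows "card (orth j) = q * Q"
proof -
  have "card (orth j) * (q * Q) = q * Q * (q * Q)"
    using card_annihilator[OF subspace[OF assms]] assms
    by (simp add: orth_def card_W card_space del: CARD_vec)
  then show ?thesis using q_gt_1 Q_pos by simp
qed

text \<open>By the uniqueness in \<open>ex1_orth\<close> the sets \<open>orth j - {0}\<close> are
  disjoint: the annihilators behave like a spread themselves, so sizes simply add.\<close>

lemma card_orth_Union:
  assumes "I \<subseteq> J"
  shows "card {w. w \<noteq> 0 \<and> (\<exists>j\<in>I. w \<in> orth j)} = card I * (q * Q - 1)"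
proof -
  have "{w. w \<noteq> 0 \<and> (\<exists>j\<in>I. w \<in> orth j)} = (\<Union>j\<in>I. orth j - {0})" by auto
  also have "card \<dots> = (\<Sum>j\<in>I. card (orth j - {0}))"
  proof (rule card_UN_disjoint)
    show "finite I" using assms J(1) by (rule finite_subset)
    show "\<forall>j\<in>I. \<forall>l\<in>I. j \<noteq> l \<longrightarrow> (orth j - {0}) \<inter> (orth l - {0}) = {}"
      using assms ex1_orth by blast
  qed simp
  also have "\<dots> = (\<Sum>j\<in>I. q * Q - 1)"
    using assms by (intro sum.cong) (auto simp: card_Diff_singleton card_orth zero_in_orth)
  finally show ?thesis by simp
qed

end

section \<open>The encoding map, its linearity and the dimension of the code\<close>

lemma CARD_nonzero:
  "CARD('a :: {finite, zero_neq_one} nonzero) = CARD('a) - 1"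
proof -
  have "CARD('a nonzero) = card (UNIV - {0 :: 'a})"
    using type_definition.card[OF type_definition_nonzero]
    by (simp add: Diff_eq Collect_neg_eq)
  then show ?thesis by (simp add: card_Diff_singleton)
qed

text \<open>With both coefficients in one argument, injectivity of a single map yields the number of
  codewords and lets words be counted through coefficient pairs.\<close>

definition encode ::
  "('k :: {field, finite} ^ 'n \<Rightarrow> 'k) \<Rightarrow> 'k \<times> ('k ^ 'n) \<Rightarrow> 'k ^ ('k ^ 'n) nonzero" where
  "encode f p = (\<chi> x. fst p * f (nonzero_val x) + scalar_product (snd p) (nonzero_val x))"

lemma code_of_eq_range: "code_of f = range (encode f)"
proof -
  have "encode f = (\<lambda>(a, w). \<chi> x. a * f (nonzero_val x) + scalar_product w (nonzero_val x))"
    by (simp add: encode_def fun_eq_iff)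
  then show ?thesis by (auto simp: code_of_def)
qed

lemma encode_add: "encode f (p + p') = encode f p + encode f p'"
  by (simp add: encode_def vec_eq_iff scalar_product_add_left algebra_simps)

lemma encode_scale: "encode f (c * fst p, c *s snd p) = c *s encode f p"
  by (simp add: encode_def vec_eq_iff scalar_product_scale_left algebra_simps)

lemma subspace_code_of: "vec.subspace (code_of f)"
proof (rule vec.subspaceI)
  have "encode f 0 = 0" by (simp add: encode_def vec_eq_iff)
  then show "0 \<in> code_of f" unfolding code_of_eq_range by (metis rangeI)
next
  fix x y assume "x \<in> code_of f" "y \<in> code_of f"
  then show "x + y \<in> code_of f"
    unfolding code_of_eq_range by (auto simp flip: encode_add)
next
  fix c x assume "x \<in> code_of f"
  then show "c *s x \<in> code_of f"
    unfolding code_of_eq_range by (auto simp flip: encode_scale)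
qed

text \<open>Passes from coordinates indexed by a type to a set of vectors, which can then be split
  along the spread.\<close>

lemma hamming_weight_encode:
  "hamming_weight (encode f (a, w)) =
     card {x. x \<noteq> 0 \<and> a * f x + scalar_product w x \<noteq> 0}"
proof -
  have "bij_betw nonzero_val {x. encode f (a, w) $ x \<noteq> 0}
      {x. x \<noteq> 0 \<and> a * f x + scalar_product w x \<noteq> 0}"
    by (rule bij_betw_byWitness[where f' = Abs_nonzero])
       (use nonzero_val in \<open>auto simp: encode_def nonzero_val_inverse Abs_nonzero_inverse\<close>)
  then show ?thesis
    unfolding hamming_weight_def by (rule bij_betw_same_card)
qed

text \<open>If two pairs have the same word, their difference encodes to the zero word, which has
  weight 0.\<close>

lemma inj_encode:
  assumes "\<And>p. p \<noteq> 0 \<Longrightarrow> hamming_weight (encode f p) \<noteq> 0"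
  shows "inj (encode f)"
proof (rule injI)
  fix p p' assume eq: "encode f p = encode f p'"
  have "encode f (p - p') + encode f p' = encode f p'"
    using eq by (simp flip: encode_add)
  then have "hamming_weight (encode f (p - p')) = 0"
    by (simp add: hamming_weight_def)
  then show "p = p'" using assms[of "p - p'"] by auto
qed

text \<open>The dimension is read off from the size: a subspace of dimension d has
  \<open>CARD('k) ^ d\<close> elements, and injectivity gives the number of words.\<close>

lemma linear_code_code_of:
  fixes f :: "'k :: {field, finite} ^ 'n \<Rightarrow> 'k"
  assumes "inj (encode f)"
  shows "linear_code (CARD('k) ^ CARD('n) - 1) (CARD('n) + 1) (code_of f)"
proof -
  have "CARD('k) ^ vec.dim (code_of f) = card (code_of f)"
    by (simp add: card_vec_subspace subspace_code_of)
  also have "\<dots> = CARD('k \<times> ('k ^ 'n))"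
    unfolding code_of_eq_range using assms by (rule card_image)
  also have "\<dots> = CARD('k) ^ (CARD('n) + 1)" by simp
  finally have "vec.dim (code_of f) = CARD('n) + 1"
    using card_field_gt_1[where 'k = 'k] by (simp only: power_inject_exp)
  then show ?thesis
    by (simp add: linear_code_def subspace_code_of CARD_nonzero)
qed

section \<open>Building a weight distribution row by row\<close>

lemma has_weight_distribution_empty: "has_weight_distribution {} []"
  by (simp add: has_weight_distribution_def)

text \<open>The sets of words are disjoint, so their counts add at every weight. Rows with the same
  weight are covered as well, because the table sums the multiplicities.\<close>

lemma has_weight_distribution_Cons:
  assumes A: "finite A" "\<And>c. c \<in> A \<Longrightarrow> hamming_weight c = u" "card A = m"
    and C: "has_weight_distribution C table" "A \<inter> C = {}"
  shows "has_weight_distribution (A \<union> C) ((u, m) # table)"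
  unfolding has_weight_distribution_def
proof (intro conjI allI)
  show "finite (A \<union> C)" using A(1) C(1) by (simp add: has_weight_distribution_def)
next
  fix v
  have "{c \<in> A \<union> C. hamming_weight c = v} =
      {c \<in> A. hamming_weight c = v} \<union> {c \<in> C. hamming_weight c = v}" by auto
  also have "card \<dots> = card {c \<in> A. hamming_weight c = v} + card {c \<in> C. hamming_weight c = v}"
    using A(1) C by (intro card_Un_disjoint) (auto simp: has_weight_distribution_def)
  also have "{c \<in> A. hamming_weight c = v} = (if u = v then A else {})"
    using A(2) by auto
  finally show "card {c \<in> A \<union> C. hamming_weight c = v} =
      (\<Sum>(u, m)\<leftarrow>(u, m) # table. if u = v then m else 0)"
    using C(1) A(3) by (simp add: has_weight_distribution_def)
qed

section \<open>The values of f on the spread\<close>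

lemma two_neq_0_if_card_3:
  assumes "CARD('k :: {field, finite}) = 3"
  shows "(2 :: 'k) \<noteq> 0"
proof
  assume 2: "(2 :: 'k) = 0"
  \<comment> \<open>Translation by 1 permutes the field, so adding 1 to each of the three elements
    leaves their sum unchanged.\<close>
  have "(\<Sum>x\<in>UNIV. x) = (\<Sum>x\<in>UNIV. x + (1 :: 'k))"
    by (rule sum.reindex_bij_witness[where i = "\<lambda>x. x + 1" and j = "\<lambda>x. x - 1"]) auto
  then have "(3 :: 'k) = 0"
    by (simp add: sum.distrib assms)
  moreover have "(3 :: 'k) = 2 + 1" by simp
  ultimately show False using 2 by simp
qed

text \<open>The value of f on the nonzero vectors of \<open>W j\<close>.\<close>

definition pair_coeff :: "(nat \<Rightarrow> nat) \<Rightarrow> nat \<Rightarrow> nat \<Rightarrow> 'k :: field" where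
  "pair_coeff i s j = (\<Sum>k = 1..s. if j = i k then 1 else if j = i (s + k) then 2 else 0)"

text \<open>By injectivity of \<open>i\<close> at most one summand is nonzero, so nothing cancels,
  and its value is 1 or 2.\<close>

lemma pair_coeff_nonzero_iff:
  assumes i: "inj_on i {1..2 * s}" and two: "(2 :: 'k :: field) \<noteq> 0"
  shows "(pair_coeff i s j :: 'k) \<noteq> 0 \<longleftrightarrow> j \<in> i ` {1..2 * s}"
proof
  assume "j \<in> i ` {1..2 * s}"
  then obtain m where m: "j = i m" "m \<in> {1..2 * s}" by blast
  have inj: "i m = i l \<longleftrightarrow> m = l" if "l \<in> {1..2 * s}" for l
    using i m that by (auto dest: inj_onD)
  \<comment> \<open>The condition \<open>s + k = m\<close> is written as \<open>k = m - s\<close>.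
    For \<open>m \<le> s\<close> truncated subtraction gives 0, which is outside the range of
    \<open>k\<close>.\<close>
  have "pair_coeff i s j = (\<Sum>k = 1..s. if k = m then 1 else if k = m - s then 2 else 0 :: 'k)"
    unfolding pair_coeff_def using m by (intro sum.cong refl) (auto simp: inj)
  also have "\<dots> = (if m \<le> s then 1 else 2)"
  proof (cases "m \<le> s")
    case True
    then have "(\<Sum>k = 1..s. if k = m then 1 else if k = m - s then 2 else 0 :: 'k) =
        (\<Sum>k = 1..s. if k = m then 1 else 0)"
      by (intro sum.cong) auto
    then show ?thesis using True m by simp
  next
    case False
    then have "(\<Sum>k = 1..s. if k = m then 1 else if k = m - s then 2 else 0 :: 'k) =
        (\<Sum>k = 1..s. if k = m - s then 2 else 0)"
      by (intro sum.cong) auto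
    moreover have "m - s \<in> {1..s}" using False m by auto
    ultimately show ?thesis using False by simp
  qed
  finally show "(pair_coeff i s j :: 'k) \<noteq> 0" using two by simp
next
  assume nz: "(pair_coeff i s j :: 'k) \<noteq> 0"
  show "j \<in> i ` {1..2 * s}"
  proof (rule ccontr)
    assume j: "j \<notin> i ` {1..2 * s}"
    have "j \<noteq> i k" if "k \<in> {1..2 * s}" for k using j that by blast
    then have "pair_coeff i s j = (0 :: 'k)"
      unfolding pair_coeff_def by (intro sum.neutral) auto
    with nz show False ..
  qed
qed

section \<open>Parameters and weight distribution of the ternary code\<close>

theorem theorem3p3:
  fixes W :: "nat \<Rightarrow> ('k :: {field, finite} ^ 'n) set"
    and n t s :: nat
    and i :: "nat \<Rightarrow> nat"
    and f :: "'k ^ 'n \<Rightarrow> 'k"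
  assumes card_field: "CARD('k) = 3"
    and n: "n = CARD('n)" "n > 0" "even n"
    and t: "t = n div 2"
    and subspaces: "\<And>j. j \<in> {1..3 ^ t + 1} \<Longrightarrow> vec.subspace (W j) \<and> vec.dim (W j) = t"
    and trivial_intersections:
      "\<And>j k. j \<in> {1..3 ^ t + 1} \<Longrightarrow> k \<in> {1..3 ^ t + 1} \<Longrightarrow> j \<noteq> k \<Longrightarrow> W j \<inter> W k = {0}"
    and s: "1 \<le> s" "real s \<le> (3 ^ t + 1) / 2"
    and indices: "inj_on i {1..2 * s}" "i ` {1..2 * s} \<subseteq> {1..3 ^ t + 1}"
    and f: "f = (\<lambda>x. \<Sum>k = 1..s. f_pair W (i k) (i (s + k)) x)"
  shows "linear_code (3 ^ n - 1) (n + 1) (code_of f) \<and>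
    has_weight_distribution (code_of f)
      [(0, 1),
       (2 * s * (3 ^ t - 1), 2),
       (3 ^ n - 3 ^ (n - 1), 3 ^ n - 1),
       (3 ^ n - 3 ^ (n - 1) - 2 * s, 2 * (3 ^ t + 1 - 2 * s) * (3 ^ t - 1)),
       (3 ^ n - 3 ^ (n - 1) + 3 ^ t - 2 * s, 4 * s * (3 ^ t - 1))]"
proof -
  define J where "J = {1..3 ^ t + 1 :: nat}"
  define I where "I = i ` {1..2 * s}"
  define c :: "nat \<Rightarrow> 'k" where "c = pair_coeff i s"
  have n_eq: "CARD('n) = 2 * t" and t_pos: "t > 0"
    using n t by presburger+
  \<comment> \<open>Instantiating \<open>q\<close> with the numeral 3 makes the counts come out in
    the form used in the table.\<close>
  interpret spread W J t 3
    using card_field n_eq t_pos subspaces trivial_intersections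
    by unfold_locales (auto simp: J_def)
  have IJ: "I \<subseteq> J" and card_I: "card I = 2 * s"
    using indices by (auto simp: I_def J_def card_image)
  have c_iff: "c j \<noteq> 0 \<longleftrightarrow> j \<in> I" for j
    unfolding c_def I_def
    by (rule pair_coeff_nonzero_iff[OF indices(1) two_neq_0_if_card_3[OF card_field]])
  have f_const: "f x = c j" if "j \<in> J" "x \<in> W j" "x \<noteq> 0" for j x
  proof -
    \<comment> \<open>A nonzero vector lies in only one spread element, so the membership tests in
      \<open>f_pair\<close> become the index tests in \<open>pair_coeff\<close>, term by
      term.\<close>
    have mem: "x \<in> W l - {0} \<longleftrightarrow> j = l" if "l \<in> J" for l
      using inter[OF \<open>j \<in> J\<close> that] \<open>x \<in> W j\<close> \<open>x \<noteq> 0\<close> by auto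
    have "i k \<in> J" if "k \<in> {1..2 * s}" for k
      using that IJ unfolding I_def by blast
    then have "i k \<in> J" "i (s + k) \<in> J" if "k \<in> {1..s}" for k
      using that by auto
    then show ?thesis
      unfolding f c_def pair_coeff_def f_pair_def by (intro sum.cong refl) (simp only: mem)
  qed
  have Qn: "3 ^ n = 3 * Q * (3 * Q)"
    unfolding n(1) n_eq mult_2 power_add power_t ..
  then have Qn1: "3 ^ (n - 1) = 3 * Q * Q"
    using n(2) by (simp add: power_eq_if)
  have D: "3 ^ n - 3 ^ (n - 1) = 6 * (Q * Q)"
    unfolding Qn Qn1 by simp
  have s_le: "2 * s \<le> 3 * Q + 1"
    using s(2) unfolding power_t[symmetric] by (simp flip: of_nat_le_iff[where 'a = real])
  \<comment> \<open>Together with \<open>s_le\<close> and \<open>Q_pos\<close> this gives 2s \<le>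
    4Q < 6Q^2, so subtracting 2s is never truncated and leaves a positive weight.\<close>
  have QQ: "Q \<le> Q * Q" using Q_pos by simp

  \<comment> \<open>Weights by type of coefficient pair\<close>
  have wt_00: "hamming_weight (encode f (0, 0)) = 0"
    by (simp add: hamming_weight_encode)
  have wt_a0: "hamming_weight (encode f (a, 0)) = 2 * s * (3 ^ t - 1)" if "a \<noteq> 0" for a
  proof -
    have "card {x \<in> W j. x \<noteq> 0 \<and> a * f x + scalar_product 0 x \<noteq> 0} =
        (if j \<in> I then 3 ^ t - 1 else 0)"
      if j: "j \<in> J" for j
    proof -
      have "{x \<in> W j. x \<noteq> 0 \<and> a * f x + scalar_product 0 x \<noteq> 0} =
          (if j \<in> I then W j - {0} else {})"
        using f_const[OF j] \<open>a \<noteq> 0\<close> c_iff[of j] by (auto intro: ccontr)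
      then show ?thesis
        using j by (simp add: card_Diff_singleton zero_in_W card_W power_t)
    qed
    then show ?thesis
      unfolding hamming_weight_encode card_nonzero_eq_sum
      using J(1) IJ by (simp add: sum.If_cases Int_absorb1 card_I)
  qed
  \<comment> \<open>Here (3Q + 1)(3Q - Q) = 6Q^2 + 2Q, and the two corrections are Q and Q - 3Q. For
    nonzero \<open>a\<close> the weights are therefore 6Q^2 + 3Q - 2s and 6Q^2 - 2s, with 3Q =
    3^t.\<close>
  have wt: "int (hamming_weight (encode f (a, w))) =
      6 * int (Q * Q) + 2 * Q - card {j \<in> J. a * c j \<noteq> 0} +
      (if \<exists>j\<in>{j \<in> J. a * c j \<noteq> 0}. w \<in> orth j then int Q else - 2 * int Q)"
    if "w \<noteq> 0" for a w
    unfolding hamming_weight_encode using that f_const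
    by (subst weight_sum[where c = "\<lambda>j. a * c j", OF _ _ refl]) (auto simp: algebra_simps)
  \<comment> \<open>For \<open>a = 0\<close> the index set in \<open>wt\<close> is empty, so the
    second correction applies and cancels 2Q.\<close>
  have wt_0w: "hamming_weight (encode f (0, w)) = 3 ^ n - 3 ^ (n - 1)" if "w \<noteq> 0" for w
    using wt[OF that, of 0] unfolding D by (simp del: of_nat_mult)
  have I_eq: "{j \<in> J. a * c j \<noteq> 0} = I" if "a \<noteq> 0" for a
    using that c_iff IJ by auto
  have wt_in: "hamming_weight (encode f (a, w)) = 3 ^ n - 3 ^ (n - 1) + 3 ^ t - 2 * s"
    if "a \<noteq> 0" "w \<noteq> 0" "j \<in> I" "w \<in> orth j" for a w j
    using wt[OF that(2), of a] bexI[of "\<lambda>j. w \<in> orth j", OF that(4) that(3)] s_le unfolding I_eq[OF that(1)] card_I D power_t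
    by (simp del: of_nat_mult)
  have wt_notin: "hamming_weight (encode f (a, w)) = 3 ^ n - 3 ^ (n - 1) - 2 * s"
    if "a \<noteq> 0" "w \<noteq> 0" "(\<forall>j\<in>I. w \<notin> orth j)" for a w
    using wt[OF that(2), of a] that(3) s_le QQ unfolding I_eq[OF that(1)] card_I D power_t
    by (simp del: of_nat_mult)
  have inj: "inj (encode f)"
  proof (rule inj_encode)
    fix p :: "'k \<times> ('k ^ 'n)" assume "p \<noteq> 0"
    then obtain a w where p: "p = (a, w)" and nz: "a \<noteq> 0 \<or> w \<noteq> 0"
      by (cases p) (auto simp: zero_prod_def)
    have pos: "3 ^ t - 1 > (0 :: nat)" "3 ^ n - 3 ^ (n - 1) - 2 * s > 0"
      using Q_pos QQ s_le unfolding D power_t by linarith+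
    consider "a \<noteq> 0" "w = 0" | "a = 0" "w \<noteq> 0"
      | "a \<noteq> 0" "w \<noteq> 0" "\<exists>j\<in>I. w \<in> orth j"
      | "a \<noteq> 0" "w \<noteq> 0" "(\<forall>j\<in>I. w \<notin> orth j)"
      using nz by blast
    then show "hamming_weight (encode f p) \<noteq> 0"
    proof cases
      case 1
      then show ?thesis using pos s(1) by (simp add: p wt_a0)
    next
      case 2
      then show ?thesis using pos unfolding p 2(1) wt_0w[OF 2(2)] by linarith
    next
      case 3
      then show ?thesis using pos wt_in[of a w] unfolding p by auto
    next
      case 4
      then show ?thesis using pos unfolding p wt_notin[OF 4] by linarith
    qed
  qed

  \<comment> \<open>Counting the coefficient pairs of each type\<close>
  let ?N = "- {0 :: 'k}"
  let ?in = "{w. w \<noteq> 0 \<and> (\<exists>j\<in>I. w \<in> orth j)}"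
  let ?out = "{w. w \<noteq> 0 \<and> (\<forall>j\<in>I. w \<notin> orth j)}"
  have card_N: "card ?N = 2"
    by (simp add: Compl_eq_Diff_UNIV card_Diff_singleton card_field)
  have card_in: "card ?in = 2 * s * (3 ^ t - 1)"
    by (simp add: card_orth_Union[OF IJ] card_I power_t)
  \<comment> \<open>The unique index given by \<open>ex1_orth\<close> lies either in
    \<open>I\<close> or in \<open>J - I\<close>, so avoiding \<open>I\<close> means meeting
    \<open>J - I\<close>.\<close>
  have "?out = {w. w \<noteq> 0 \<and> (\<exists>j\<in>J - I. w \<in> orth j)}"
    using ex1_orth IJ by blast
  then have card_out: "card ?out = (3 ^ t + 1 - 2 * s) * (3 ^ t - 1)"
    using card_Diff_subset[OF finite_subset[OF IJ J(1)] IJ]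
    by (simp add: card_orth_Union card_I J power_t)
  have card_enc: "card (encode f ` A) = card A" for A
    using inj by (intro card_image) (rule inj_on_subset, auto)
  have disj: "encode f ` A \<inter> encode f ` B = {}" if "A \<inter> B = {}" for A B
    using that inj by (simp flip: image_Int)
  \<comment> \<open>One set of pairs for each row, in the order of the table. The final
    \<open>{}\<close> corresponds to the empty list.\<close>
  have split: "UNIV =
      {(0, 0)} \<union> (?N \<times> {0} \<union> ({0} \<times> - {0} \<union> (?N \<times> ?out \<union> (?N \<times> ?in \<union> {}))))"
    by auto
  have "has_weight_distribution (encode f ` UNIV)
      [(0, 1),
       (2 * s * (3 ^ t - 1), 2),
       (3 ^ n - 3 ^ (n - 1), 3 ^ n - 1),
       (3 ^ n - 3 ^ (n - 1) - 2 * s, 2 * (3 ^ t + 1 - 2 * s) * (3 ^ t - 1)),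
       (3 ^ n - 3 ^ (n - 1) + 3 ^ t - 2 * s, 4 * s * (3 ^ t - 1))]"
    unfolding split image_Un image_empty
  proof (intro has_weight_distribution_Cons has_weight_distribution_empty)
    show "card (encode f ` ({0} \<times> - {0})) = 3 ^ n - 1"
      unfolding card_enc card_cartesian_product
      by (simp add: Compl_eq_Diff_UNIV card_Diff_singleton card_field n(1))
  qed (auto simp: card_enc card_cartesian_product card_N card_in card_out wt_a0 wt_0w wt_in wt_notin
      wt_00 simp flip: image_Un intro: ccontr dest!: injD[OF inj])
  then show ?thesis
    using linear_code_code_of[OF inj] unfolding code_of_eq_range card_field n(1) by simp
qed

end
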